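(* As $n\to\infty$, the expected local dimension of a poset chosen uniformly at random from the set of all partial orders on the labelled ground set $[n]$ is at least \[\left(\frac14-o(1)\right)\frac{n}{\log n}.\]
   Context: Logarithms are base 2. For a poset $P=(X,\le)$, a partial linear extension is a linear order $L=(Y,\le_L)$ with $Y\subseteq X$ such that $x\le y$ implies $x\le_L y$ for $x,y\in Y$. A local realiser of $P$ is a set $\mathcal{L}$ of partial linear extensions such that for every ordered pair $(x,y)$ with $x\not\ge y$ some $L\in\mathcal{L}$ contains both $x,y$ and has $x\le_L y$. The multiplicity $\mu_{\mathcal{L}}(x)$ is the number of members of $\mathcal{L}$ whose ground set contains $x$; the local dimension $\operatorname{ldim}(P)$ is the minimum over local realisers $\mathcal{L}$ of $\max_{x\in X}\mu_{\mathcal{L}}(x)$. *)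

theory Defs
  imports "HOL-Probability.Probability" "HOL-Library.Landau_Symbols"
begin

text \<open>
  A poset with ground set \<open>X\<close> is given by its order relation \<open>P\<close>, where
  \<open>(x, y) \<in> P\<close> means \<open>x \<le> y\<close>. Note that \<^const>\<open>partial_order_on\<close> and \<^const>\<open>linear_order_on\<close>
  require the relation to be contained in the square of its ground set. A linear order on a subset
  of \<open>X\<close> is a pair \<open>(Y, L)\<close> consisting of its ground set and its order relation.
\<close>

definition partial_linear_extension ::
  "'a set \<Rightarrow> 'a rel \<Rightarrow> 'a set \<times> 'a rel \<Rightarrow> bool" where
  "partial_linear_extension X P = (\<lambda>(Y, L).
     Y \<subseteq> X \<and> linear_order_on Y L \<and> (\<forall>x\<in>Y. \<forall>y\<in>Y. (x, y) \<in> P \<longrightarrow> (x, y) \<in> L))"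

definition local_realiser ::
  "'a set \<Rightarrow> 'a rel \<Rightarrow> ('a set \<times> 'a rel) set \<Rightarrow> bool" where
  "local_realiser X P \<L> \<longleftrightarrow>
     (\<forall>L\<in>\<L>. partial_linear_extension X P L) \<and>
     (\<forall>x\<in>X. \<forall>y\<in>X. (y, x) \<notin> P \<longrightarrow>
        (\<exists>(Y, L)\<in>\<L>. x \<in> Y \<and> y \<in> Y \<and> (x, y) \<in> L))"

definition multiplicity_in :: "('a set \<times> 'a rel) set \<Rightarrow> 'a \<Rightarrow> nat" where
  "multiplicity_in \<L> x = card {(Y, L) \<in> \<L>. x \<in> Y}"

text \<open>
  The definition is meant for finite nonempty \<open>X\<close>. Then all local realisers are finite, so the
  cardinalities above are genuine, and a local realiser always exists, so that \<^const>\<open>Inf\<close> on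
  the natural numbers is the minimum.
\<close>

definition ldim :: "'a set \<Rightarrow> 'a rel \<Rightarrow> nat" where
  "ldim X P = Inf {Max (multiplicity_in \<L> ` X) | \<L>. local_realiser X P \<L>}"

definition partial_orders_on :: "'a set \<Rightarrow> 'a rel set" where
  "partial_orders_on X = {P. partial_order_on X P}"

definition expected_ldim :: "nat \<Rightarrow> real" where
  "expected_ldim n =
     measure_pmf.expectation (pmf_of_set (partial_orders_on {1..n})) (\<lambda>P. real (ldim {1..n} P))"

end

theory Submission
  imports Defs "HOL-Real_Asymp.Real_Asymp"
begin

text \<open>
  A local realiser determines its poset. If all multiplicities are at most \<open>k\<close>, then the
  concatenation of its partial linear extensions is a word of length at most \<open>n k\<close> over \<open>n\<close>
  letters, and one extra bit per letter marks where each extension ends. So at most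
  \<open>(2 n) ^ (n k)\<close> posets have local dimension at most \<open>k\<close>. On the other hand, the bipartite posets
  alone number \<open>2 ^ (\<lfloor>n / 2\<rfloor> \<lceil>n / 2\<rceil>)\<close>, so for \<open>k\<close> slightly below \<open>n / (4 log n)\<close> almost all
  posets have larger local dimension.
\<close>

subsection \<open>Encoding a list of nonempty lists as a single word\<close>

text \<open>\<open>True\<close> marks the last letter of a block. A decoder suits the count: once it
  is onto the lists of nonempty blocks, words bound their number. The inner \<open>[]\<close> branch
  is reached only by a word that ends unmarked.\<close>

fun split_marked :: "('a \<times> bool) list \<Rightarrow> 'a list list" where
  "split_marked [] = []"
| "split_marked ((x, True) # w) = [x] # split_marked w"
| "split_marked ((x, False) # w) =
     (case split_marked w of [] \<Rightarrow> [[x]] | xs # xss \<Rightarrow> (x # xs) # xss)"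

text \<open>The word \<open>u\<close> marks only the last letter of \<open>xs\<close>. Allowing
  every continuation \<open>w\<close> lets such words be glued block by block.\<close>

lemma split_marked_Cons:
  assumes "xs \<noteq> []"
  shows "\<exists>u. map fst u = xs \<and> (\<forall>w. split_marked (u @ w) = xs # split_marked w)"
  using assms
proof (induction xs rule: list_nonempty_induct)
  case (single x)
  show ?case by (rule exI[of _ "[(x, True)]"]) simp
next
  case (cons x xs)
  then obtain u where "map fst u = xs" "\<forall>w. split_marked (u @ w) = xs # split_marked w"
    by blast
  then show ?case by (intro exI[of _ "(x, False) # u"]) simp
qed

lemma split_marked_surj:
  assumes "[] \<notin> set xss"
  shows "\<exists>w. map fst w = concat xss \<and> split_marked w = xss"
  using assms
proof (induction xss)
  case Nil
  show ?case by (rule exI[of _ "[]"]) simp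
next
  case (Cons xs xss)
  then obtain w where w: "map fst w = concat xss" "split_marked w = xss" by auto
  from Cons.prems obtain u where "map fst u = xs" "split_marked (u @ w) = xs # split_marked w"
    using split_marked_Cons[of xs] by auto
  with w show ?case by (intro exI[of _ "u @ w"]) simp
qed

text \<open>Each member of \<open>S\<close> is decoded from a word of length \<open>N\<close> over
  \<open>2 * card A\<close> marked letters. Empty blocks are excluded because they add no length and
  could be inserted without limit.\<close>

lemma card_nonempty_lists_concat_length:
  fixes A :: "'a set" and N :: nat
  assumes "finite A"
  defines "S \<equiv> {xss. [] \<notin> set xss \<and> set (concat xss) \<subseteq> A \<and> length (concat xss) = N}"
  shows "finite S" and "card S \<le> (2 * card A) ^ N"
proof -
  let ?W = "{w. set w \<subseteq> A \<times> (UNIV :: bool set) \<and> length w = N}"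
  have fin: "finite ?W" using assms by (intro finite_lists_length_eq) auto
  have sub: "S \<subseteq> split_marked ` ?W"
  proof
    fix xss assume xss: "xss \<in> S"
    then obtain w where w: "map fst w = concat xss" "split_marked w = xss"
      using split_marked_surj unfolding S_def by blast
    have "length w = N" using w(1) xss by (metis (mono_tags, lifting) S_def length_map mem_Collect_eq)
    moreover have "fst ` set w \<subseteq> A" using w(1) xss unfolding S_def
      by (metis (mono_tags, lifting) image_set mem_Collect_eq)
    ultimately have "w \<in> ?W" by auto
    then show "xss \<in> split_marked ` ?W" using w(2) by blast
  qed
  show "finite S" using sub fin by (meson finite_imageI finite_subset)
  have "card S \<le> card ?W" using sub fin by (meson card_image_le card_mono finite_imageI le_trans)
  also have "\<dots> = (2 * card A) ^ N"
    using assms by (subst card_lists_length_eq) (auto simp: card_cartesian_product mult.commute)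
  finally show "card S \<le> (2 * card A) ^ N" .
qed

subsection \<open>Posets of small local dimension\<close>

definition precedes_in :: "'a list \<Rightarrow> 'a \<Rightarrow> 'a \<Rightarrow> bool" where
  "precedes_in xs x y \<longleftrightarrow> (\<exists>i j. i < j \<and> j < length xs \<and> xs ! i = x \<and> xs ! j = y)"

lemma linear_order_list:
  assumes "finite Y" and lin: "linear_order_on Y L"
  shows "\<exists>xs. distinct xs \<and> set xs = Y \<and>
    (\<forall>x y. precedes_in xs x y \<longleftrightarrow> (x, y) \<in> L \<and> x \<noteq> y)"
proof -
  have LY: "L \<subseteq> Y \<times> Y" and tr: "trans L" and as: "antisym L" and rf: "refl_on Y L"
    and tot: "total_on Y L"
    using lin by (auto simp: order_on_defs)
  \<comment> \<open>The size of the down-set strictly increases along \<open>L\<close>, so sorting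
    by it lists \<open>Y\<close> in the order \<open>L\<close>.\<close>
  define f where "f x = card {z. (z, x) \<in> L}" for x
  have fin: "finite {z. (z, x) \<in> L}" for x
    by (rule finite_subset[OF _ \<open>finite Y\<close>]) (use LY in auto)
  have f_less: "f x < f y" if "(x, y) \<in> L" "x \<noteq> y" for x y
    unfolding f_def
  proof (rule psubset_card_mono[OF fin], rule psubsetI)
    show "{z. (z, x) \<in> L} \<subseteq> {z. (z, y) \<in> L}" using that tr by (auto dest: transD)
    have "(y, y) \<in> L" using that LY rf by (auto dest: refl_onD)
    moreover have "(y, x) \<notin> L" using that as by (auto dest: antisymD)
    ultimately show "{z. (z, x) \<in> L} \<noteq> {z. (z, y) \<in> L}" by blast
  qed
  obtain ys where ys: "set ys = Y" "distinct ys" using finite_distinct_list[OF \<open>finite Y\<close>] by blast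
  define xs where "xs = sort_key f ys"
  have xs: "set xs = Y" "distinct xs" "sorted (map f xs)" using ys by (auto simp: xs_def)
  have prec: "(xs ! i, xs ! j) \<in> L \<and> xs ! i \<noteq> xs ! j" if "i < j" "j < length xs" for i j
  proof -
    have ne: "xs ! i \<noteq> xs ! j" using that xs(2) by (simp add: nth_eq_iff_index_eq)
    have "f (xs ! i) \<le> f (xs ! j)"
      using sorted_nth_mono[OF xs(3), of i j] that by simp
    then have "(xs ! j, xs ! i) \<notin> L" using f_less ne by (metis leD)
    moreover have "xs ! i \<in> Y" "xs ! j \<in> Y" using that xs(1) by auto
    ultimately show ?thesis using tot ne by (auto simp: total_on_def)
  qed
  have "precedes_in xs x y \<longleftrightarrow> (x, y) \<in> L \<and> x \<noteq> y" for x y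
  proof
    assume "precedes_in xs x y"
    then show "(x, y) \<in> L \<and> x \<noteq> y" using prec by (auto simp: precedes_in_def)
  next
    assume xy: "(x, y) \<in> L \<and> x \<noteq> y"
    then obtain i j where ij: "i < length xs" "xs ! i = x" "j < length xs" "xs ! j = y"
      using LY xs(1) by (metis in_set_conv_nth mem_Sigma_iff subsetD)
    have "\<not> j < i" using prec[of j i] ij xy as by (auto dest: antisymD)
    moreover have "i \<noteq> j" using ij xy by auto
    ultimately show "precedes_in xs x y" using ij unfolding precedes_in_def
      by (metis linorder_neqE_nat)
  qed
  then show ?thesis using xs by blast
qed

text \<open>The negation fits local realisers: on \<open>X\<close>, some member puts
  \<open>y\<close> strictly before \<open>x\<close> exactly when \<open>(x, y)\<close> lies outside
  the order.\<close>

definition poset_of_lists :: "'a set \<Rightarrow> 'a list list \<Rightarrow> 'a rel" where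
  "poset_of_lists X xss = {(x, y) \<in> X \<times> X. \<not> (\<exists>xs\<in>set xss. precedes_in xs y x)}"

lemma local_realiser_finite:
  assumes "finite X" "local_realiser X P \<L>"
  shows "finite \<L>"
proof (rule finite_subset)
  show "\<L> \<subseteq> Pow X \<times> Pow (X \<times> X)"
    using assms(2)
    by (fastforce simp: local_realiser_def partial_linear_extension_def order_on_defs)
  show "finite (Pow X \<times> Pow (X \<times> X))" using assms(1) by simp
qed

text \<open>The two-element partial linear extensions already form a local realiser.\<close>

lemma local_realiser_exists: "\<exists>\<L>. local_realiser X P \<L>"
proof -
  let ?c = "\<lambda>(x, y). ({x, y}, {(x, x), (x, y), (y, y)})"
  let ?\<L> = "?c ` {(x, y) \<in> X \<times> X. (y, x) \<notin> P}"
  have ple: "partial_linear_extension X P (?c (x, y))"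
    if "x \<in> X" "y \<in> X" "(y, x) \<notin> P" for x y
  proof -
    let ?L = "{(x, x), (x, y), (y, y)}"
    have "refl_on {x, y} ?L" "?L \<subseteq> {x, y} \<times> {x, y}" "total_on {x, y} ?L"
      by (auto simp: refl_on_def total_on_def)
    moreover have "trans ?L" by (rule transI) auto
    moreover have "antisym ?L" by (rule antisymI) auto
    ultimately show ?thesis
      using that by (auto simp: partial_linear_extension_def order_on_defs)
  qed
  have "local_realiser X P ?\<L>"
    unfolding local_realiser_def
  proof (intro conjI ballI impI)
    fix L assume "L \<in> ?\<L>"
    then show "partial_linear_extension X P L" using ple by blast
  next
    fix x y assume "x \<in> X" "y \<in> X" "(y, x) \<notin> P"
    then show "\<exists>(Y, L)\<in>?\<L>. x \<in> Y \<and> y \<in> Y \<and> (x, y) \<in> L"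
      by (intro bexI[of _ "?c (x, y)"]) auto
  qed
  then show ?thesis by blast
qed

text \<open>The infimum of a nonempty set of naturals is attained, so a bound on \<open>ldim\<close>
  yields a concrete realiser to encode.\<close>

lemma ldim_realiser:
  assumes "finite X" "ldim X P \<le> k"
  shows "\<exists>\<L>. local_realiser X P \<L> \<and> (\<forall>x\<in>X. multiplicity_in \<L> x \<le> k)"
proof -
  let ?K = "{Max (multiplicity_in \<L> ` X) | \<L>. local_realiser X P \<L>}"
  have "?K \<noteq> {}" using local_realiser_exists[of X P] by blast
  from Inf_nat_def1[OF this] obtain \<L> where
    \<L>: "local_realiser X P \<L>" "ldim X P = Max (multiplicity_in \<L> ` X)"
    unfolding ldim_def by auto
  have "multiplicity_in \<L> x \<le> k" if "x \<in> X" for x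
  proof -
    have "multiplicity_in \<L> x \<le> Max (multiplicity_in \<L> ` X)" using that assms(1) by simp
    then show ?thesis using assms(2) \<L>(2) by linarith
  qed
  then show ?thesis using \<L>(1) by blast
qed

text \<open>Double counting of the incidences between elements and the ground sets containing
  them.\<close>

lemma sum_card_eq_sum_multiplicity:
  assumes "finite X" "finite \<L>" "\<forall>(Y, L)\<in>\<L>. Y \<subseteq> X"
  shows "(\<Sum>(Y, L)\<in>\<L>. card Y) = (\<Sum>x\<in>X. multiplicity_in \<L> x)"
proof -
  have "(\<Sum>(Y, L)\<in>\<L>. card Y) = (\<Sum>p\<in>\<L>. card {x \<in> X. x \<in> fst p})"
  proof (rule sum.cong[OF refl], clarify)
    fix Y L assume "(Y, L) \<in> \<L>"
    then have "{x \<in> X. x \<in> Y} = Y" using assms(3) by auto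
    then show "card Y = card {x \<in> X. x \<in> fst (Y, L)}" by simp
  qed
  also have "\<dots> = (\<Sum>x\<in>X. card {p \<in> \<L>. x \<in> fst p})"
    using sum_multicount_gen[OF assms(2,1), of "\<lambda>p x. x \<in> fst p" "\<lambda>x. card {p \<in> \<L>. x \<in> fst p}"]
    by simp
  also have "\<dots> = (\<Sum>x\<in>X. multiplicity_in \<L> x)"
    unfolding multiplicity_in_def by (intro sum.cong arg_cong[where f = card]) auto
  finally show ?thesis .
qed

text \<open>Writing each extension as a list gives total length at most \<open>card X * k\<close> by
  double counting. Padding with \<open>[a]\<close> makes the length exact, so a single power counts
  all cases.\<close>

lemma poset_of_lists_realiser:
  assumes fin: "finite X" and po: "partial_order_on X P" and "a \<in> X"
    and real: "local_realiser X P \<L>" and mult: "\<forall>x\<in>X. multiplicity_in \<L> x \<le> k"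
  shows "\<exists>xss. [] \<notin> set xss \<and> set (concat xss) \<subseteq> X \<and> length (concat xss) = card X * k \<and>
    P = poset_of_lists X xss"
proof -
  have rf: "refl_on X P" and PX: "P \<subseteq> X \<times> X"
    using po by (auto simp: order_on_defs)
  have ple: "Y \<subseteq> X" "linear_order_on Y L" "finite Y"
    "\<And>x y. x \<in> Y \<Longrightarrow> y \<in> Y \<Longrightarrow> (x, y) \<in> P \<Longrightarrow> (x, y) \<in> L" if "(Y, L) \<in> \<L>" for Y L
    using real that fin
    by (auto simp: local_realiser_def partial_linear_extension_def dest: finite_subset)
  have "\<exists>xs. distinct xs \<and> set xs = fst p \<and>
    (\<forall>x y. precedes_in xs x y \<longleftrightarrow> (x, y) \<in> snd p \<and> x \<noteq> y)" if "p \<in> \<L>" for p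
    using that linear_order_list[of "fst p" "snd p"] ple[of "fst p" "snd p"] by simp
  then obtain l where l: "\<And>p. p \<in> \<L> \<Longrightarrow> distinct (l p)" "\<And>p. p \<in> \<L> \<Longrightarrow> set (l p) = fst p"
    "\<And>p x y. p \<in> \<L> \<Longrightarrow> precedes_in (l p) x y \<longleftrightarrow> (x, y) \<in> snd p \<and> x \<noteq> y"
    by metis
  have fin\<L>: "finite \<L>" using local_realiser_finite[OF fin real] .
  \<comment> \<open>Extensions with empty ground set are dropped: the encoding admits only nonempty
    blocks, and they order no pair.\<close>
  obtain ps where ps: "set ps = {p \<in> \<L>. fst p \<noteq> {}}" "distinct ps"
    using finite_distinct_list[of "{p \<in> \<L>. fst p \<noteq> {}}"] fin\<L> by auto
  have "length (concat (map l ps)) = (\<Sum>p\<in>set ps. length (l p))"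
    using ps(2) by (simp add: length_concat sum_list_distinct_conv_sum_set comp_def)
  also have "\<dots> = (\<Sum>p\<in>set ps. card (fst p))"
  proof (rule sum.cong[OF refl])
    fix p assume "p \<in> set ps"
    then have "p \<in> \<L>" using ps(1) by simp
    from distinct_card[OF l(1)[OF this]] show "length (l p) = card (fst p)"
      by (simp only: l(2)[OF \<open>p \<in> \<L>\<close>])
  qed
  also have "\<dots> \<le> (\<Sum>p\<in>\<L>. card (fst p))"
    by (rule sum_mono2[OF fin\<L>]) (simp_all add: ps(1))
  also have "\<dots> = (\<Sum>(Y, L)\<in>\<L>. card Y)"
    by (simp add: case_prod_unfold)
  also have "\<dots> = (\<Sum>x\<in>X. multiplicity_in \<L> x)"
    using ple(1) by (intro sum_card_eq_sum_multiplicity fin fin\<L>) auto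
  also have "\<dots> \<le> card X * k"
    using mult sum_bounded_above[of X "multiplicity_in \<L>" k] by simp
  finally have len: "length (concat (map l ps)) \<le> card X * k" .
  \<comment> \<open>Singleton lists carry no order information, so they can be used for padding.\<close>
  define xss where "xss = map l ps @ replicate (card X * k - length (concat (map l ps))) [a]"
  have singleton: "\<not> precedes_in [a] x y" for x y by (simp add: precedes_in_def)
  have "[] \<notin> set xss" using l(2) ps(1) by (force simp: xss_def)
  moreover have "set (concat xss) \<subseteq> X"
    using l(2) ps(1) ple(1) \<open>a \<in> X\<close> by (force simp: xss_def)
  moreover have "length (concat xss) = card X * k"
    using len by (simp add: xss_def length_concat sum_list_replicate)
  moreover have "P = poset_of_lists X xss"
  proof -
    have prec: "(\<exists>xs\<in>set xss. precedes_in xs y x) \<longleftrightarrow>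
      (\<exists>p\<in>\<L>. (y, x) \<in> snd p \<and> x \<noteq> y)" for x y
    proof
      assume "\<exists>xs\<in>set xss. precedes_in xs y x"
      then show "\<exists>p\<in>\<L>. (y, x) \<in> snd p \<and> x \<noteq> y"
        using singleton l(3) ps(1) by (fastforce simp: xss_def)
    next
      assume "\<exists>p\<in>\<L>. (y, x) \<in> snd p \<and> x \<noteq> y"
      then obtain p where p: "p \<in> \<L>" "(y, x) \<in> snd p" "x \<noteq> y" by blast
      have "fst p \<noteq> {}" using p ple(2)[of "fst p" "snd p"] by (auto simp: order_on_defs)
      then have "l p \<in> set xss" using p ps(1) by (auto simp: xss_def)
      then show "\<exists>xs\<in>set xss. precedes_in xs y x" using l(3) p by blast
    qed
    have "(x, y) \<in> P \<longleftrightarrow> (x, y) \<in> poset_of_lists X xss" for x y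
    proof
      assume xy: "(x, y) \<in> P"
      \<comment> \<open>Such an extension would also contain \<open>(x, y)\<close>, as it respects
        \<open>P\<close>, against antisymmetry.\<close>
      have "\<not> (\<exists>p\<in>\<L>. (y, x) \<in> snd p \<and> x \<noteq> y)"
      proof
        assume "\<exists>p\<in>\<L>. (y, x) \<in> snd p \<and> x \<noteq> y"
        then obtain Y L where p: "(Y, L) \<in> \<L>" "(y, x) \<in> L" "x \<noteq> y" by auto
        have "x \<in> Y" "y \<in> Y" "antisym L" using ple(2)[OF p(1)] p(2) by (auto simp: order_on_defs)
        then show False using ple(4)[OF p(1)] p xy by (auto dest: antisymD)
      qed
      then show "(x, y) \<in> poset_of_lists X xss"
        using xy PX prec by (auto simp: poset_of_lists_def)
    next
      assume "(x, y) \<in> poset_of_lists X xss"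
      then have "x \<in> X" "y \<in> X" and no: "\<not> (\<exists>p\<in>\<L>. (y, x) \<in> snd p \<and> x \<noteq> y)"
        using prec by (auto simp: poset_of_lists_def)
      show "(x, y) \<in> P"
      proof (rule ccontr)
        assume n: "(x, y) \<notin> P"
        then have "x \<noteq> y" using rf \<open>x \<in> X\<close> by (auto dest: refl_onD)
        \<comment> \<open>The realiser condition is applied to the swapped pair
          \<open>(y, x)\<close>, whose premise is \<open>(x, y) \<notin> P\<close>.\<close>
        moreover obtain Y L where "(Y, L) \<in> \<L>" "(y, x) \<in> L"
          using real n \<open>x \<in> X\<close> \<open>y \<in> X\<close> unfolding local_realiser_def by blast
        ultimately show False using no by (auto simp: Bex_def)
      qed
    qed
    then show ?thesis by auto
  qed
  ultimately show ?thesis by blast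
qed

lemma finite_partial_orders_on: "finite X \<Longrightarrow> finite (partial_orders_on X)"
  by (rule finite_subset[of _ "Pow (X \<times> X)"]) (auto simp: partial_orders_on_def order_on_defs)

text \<open>These posets lie in the image of the counted lists under \<open>poset_of_lists\<close>.
  Lists whose image is no partial order only enlarge the bound.\<close>

lemma card_ldim_le:
  assumes "finite X" "X \<noteq> {}"
  shows "card {P \<in> partial_orders_on X. ldim X P \<le> k} \<le> (2 * card X) ^ (card X * k)"
proof -
  let ?S = "{xss. [] \<notin> set xss \<and> set (concat xss) \<subseteq> X \<and> length (concat xss) = card X * k}"
  obtain a where "a \<in> X" using assms(2) by blast
  have "{P \<in> partial_orders_on X. ldim X P \<le> k} \<subseteq> poset_of_lists X ` ?S"
  proof
    fix P assume "P \<in> {P \<in> partial_orders_on X. ldim X P \<le> k}"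
    then have po: "partial_order_on X P" "ldim X P \<le> k" by (auto simp: partial_orders_on_def)
    then obtain \<L> where "local_realiser X P \<L>" "\<forall>x\<in>X. multiplicity_in \<L> x \<le> k"
      using ldim_realiser[OF assms(1)] by blast
    from poset_of_lists_realiser[OF assms(1) po(1) \<open>a \<in> X\<close> this]
    show "P \<in> poset_of_lists X ` ?S" by blast
  qed
  then have "card {P \<in> partial_orders_on X. ldim X P \<le> k} \<le> card ?S"
    using card_nonempty_lists_concat_length(1)[OF assms(1), of "card X * k"]
    by (meson card_image_le card_mono finite_imageI le_trans)
  also have "\<dots> \<le> (2 * card X) ^ (card X * k)"
    using card_nonempty_lists_concat_length(2)[OF assms(1)] .
  finally show ?thesis .
qed

subsection \<open>Many bipartite posets\<close>

text \<open>Any \<open>S \<subseteq> A \<times> B\<close> plus the diagonal is a partial order: no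
  pair of \<open>S\<close> ends where another begins, so no two of them compose.\<close>

lemma card_partial_orders_on_ge:
  assumes "finite A" "finite B" "A \<inter> B = {}"
  shows "2 ^ (card A * card B) \<le> card (partial_orders_on (A \<union> B))"
proof -
  let ?f = "\<lambda>S. Id_on (A \<union> B) \<union> S"
  have "inj_on ?f (Pow (A \<times> B))"
    \<comment> \<open>The diagonal misses \<open>A \<times> B\<close> by disjointness, so
      intersecting recovers \<open>S\<close>.\<close>
    using assms(3) by (intro inj_on_inverseI[where g = "\<lambda>R. R \<inter> A \<times> B"]) auto
  then have "card (?f ` Pow (A \<times> B)) = 2 ^ (card A * card B)"
    using assms by (simp add: card_image card_Pow card_cartesian_product)
  moreover have "?f ` Pow (A \<times> B) \<subseteq> partial_orders_on (A \<union> B)"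
  proof clarify
    fix S assume S: "S \<subseteq> A \<times> B"
    then have AB: "x \<in> A \<and> y \<in> B \<and> x \<notin> B \<and> y \<notin> A" if "(x, y) \<in> S" for x y
      using assms(3) that by auto
    have "trans (?f S)" by (rule transI) (auto dest: AB)
    moreover have "antisym (?f S)" by (rule antisymI) (auto dest: AB)
    moreover have "refl_on (A \<union> B) (?f S)" "?f S \<subseteq> (A \<union> B) \<times> (A \<union> B)"
      by (auto simp: refl_on_def dest: AB)
    ultimately show "?f S \<in> partial_orders_on (A \<union> B)"
      by (auto simp: partial_orders_on_def order_on_defs)
  qed
  ultimately show ?thesis
    using finite_partial_orders_on[of "A \<union> B"] assms(1,2) by (metis card_mono finite_UnI)
qed

text \<open>With halves as equal as possible, the product of their sizes is \<open>n^2 / 4\<close>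
  for even \<open>n\<close> and \<open>(n^2 - 1) / 4\<close> for odd \<open>n\<close>; the exponent
  covers both.\<close>

lemma card_partial_orders_on_nat_ge:
  "2 powr ((real n ^ 2 - 1) / 4) \<le> card (partial_orders_on {1..n})"
proof -
  define m where "m = n div 2"
  have un: "{1..m} \<union> {m + 1..n} = {1..n}" by (auto simp: m_def)
  have "2 ^ (m * (n - m)) \<le> card (partial_orders_on {1..n})"
    using card_partial_orders_on_ge[of "{1..m}" "{m + 1..n}"] un by auto
  then have "real (2 ^ (m * (n - m))) \<le> card (partial_orders_on {1..n})"
    using of_nat_mono by blast
  moreover have "(real n ^ 2 - 1) / 4 \<le> real (m * (n - m))"
  proof (cases "even n")
    case True
    then obtain t where "n = 2 * t" by blast
    then show ?thesis by (simp add: m_def power2_eq_square)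
  next
    case False
    then obtain t where "n = 2 * t + 1" by (auto elim: oddE)
    then show ?thesis by (simp add: m_def power2_eq_square field_simps)
  qed
  then have "2 powr ((real n ^ 2 - 1) / 4) \<le> (2::real) powr real (m * (n - m))"
    by (intro powr_mono) auto
  moreover have "(2::real) powr real (m * (n - m)) = real (2 ^ (m * (n - m)))"
    by (subst powr_realpow) auto
  ultimately show ?thesis by linarith
qed

subsection \<open>The expectation\<close>

text \<open>A Markov-type bound: posets outside \<open>?B\<close> contribute at least
  \<open>k + 1\<close> by integrality, the others at least \<open>0\<close>.\<close>

lemma expected_ldim_ge_tail:
  assumes "n \<ge> 1"
  shows "expected_ldim n \<ge> (real k + 1) *
    (1 - real ((2 * n) ^ (n * k)) / real (card (partial_orders_on {1..n})))"
proof -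
  let ?X = "{1..n}" and ?O = "partial_orders_on {1..n}"
  let ?B = "{P \<in> ?O. ldim ?X P \<le> k}"
  have fin: "finite ?O" by (rule finite_partial_orders_on) simp
  have "0 < 2 powr ((real n ^ 2 - 1) / 4)" by simp
  also note card_partial_orders_on_nat_ge
  finally have pos: "0 < real (card ?O)" .
  then have ne: "?O \<noteq> {}" by auto
  have bad: "real (card ?B) \<le> real ((2 * n) ^ (n * k))"
    using card_ldim_le[of ?X k] assms by (intro of_nat_mono) auto
  have "(real k + 1) * (real (card ?O) - real ((2 * n) ^ (n * k)))
      \<le> (real k + 1) * (real (card ?O) - real (card ?B))"
    using bad by (intro mult_left_mono) auto
  also have "\<dots> = (real k + 1) * real (card (?O - ?B))"
    using fin by (subst card_Diff_subset) (auto simp: of_nat_diff card_mono)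
  also have "\<dots> = (\<Sum>P\<in>?O - ?B. real k + 1)" by simp
  also have "\<dots> \<le> (\<Sum>P\<in>?O - ?B. real (ldim ?X P))" by (intro sum_mono) auto
  also have "\<dots> \<le> (\<Sum>P\<in>?O. real (ldim ?X P))" using fin by (intro sum_mono2) auto
  also have "\<dots> = expected_ldim n * real (card ?O)"
    unfolding expected_ldim_def using fin ne pos by (subst integral_pmf_of_set) auto
  finally have "(real k + 1) * (real (card ?O) - real ((2 * n) ^ (n * k))) / real (card ?O)
      \<le> expected_ldim n"
    using pos by (simp add: pos_divide_le_eq)
  then show ?thesis using pos by (simp add: field_simps)
qed

text \<open>
  The choice \<open>k = \<lfloor>(n / 4 - 1) / log (2 n)\<rfloor>\<close> gives \<open>(2 n) ^ (n k) \<le> 2 powr (n^2 / 4 - n)\<close>.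
\<close>

lemma expected_ldim_ge:
  assumes "n \<ge> 4"
  shows "expected_ldim n \<ge>
    (real n / 4 - 1) / log 2 (2 * real n) * (1 - 2 powr (1 / 4 - real n))"
proof -
  let ?c = "real (card (partial_orders_on {1..n}))"
  define q where "q = (real n / 4 - 1) / log 2 (2 * real n)"
  define k where "k = nat \<lfloor>q\<rfloor>"
  have lpos: "log 2 (2 * real n) > 0" using assms by simp
  \<comment> \<open>Here \<open>n \<ge> 4\<close> enters; it keeps \<open>nat\<close> from
    truncating a negative floor.\<close>
  then have "q \<ge> 0" using assms by (simp add: q_def)
  \<comment> \<open>Rounding down costs nothing, since the tail bound has the factor
    \<open>k + 1 \<ge> q\<close>.\<close>
  then have k: "real k \<le> q" "q \<le> real k + 1" unfolding k_def by linarith+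
  have "real ((2 * n) ^ (n * k)) = (2 * real n) powr (real n * real k)"
    using assms by (subst of_nat_mult[symmetric], subst powr_realpow) auto
  also have "\<dots> = 2 powr (log 2 (2 * real n) * (real n * real k))"
    using assms by (subst powr_powr[symmetric]) simp
  also have "\<dots> \<le> 2 powr (real n ^ 2 / 4 - real n)"
  proof (intro powr_mono)
    have "log 2 (2 * real n) * real k \<le> real n / 4 - 1"
      using k(1) lpos by (simp add: q_def field_simps)
    then have "real n * (log 2 (2 * real n) * real k) \<le> real n * (real n / 4 - 1)"
      by (intro mult_left_mono) auto
    then show "log 2 (2 * real n) * (real n * real k) \<le> real n ^ 2 / 4 - real n"
      by (simp add: algebra_simps power2_eq_square)
  qed simp
  \<comment> \<open>The exponent is split to expose the lower bound on the number of posets; the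
    \<open>1 / 4\<close> offsets the \<open>- 1\<close> there.\<close>
  also have "\<dots> = 2 powr (1 / 4 - real n) * 2 powr ((real n ^ 2 - 1) / 4)"
    by (simp add: powr_add[symmetric] field_simps)
  also have "\<dots> \<le> 2 powr (1 / 4 - real n) * ?c"
    using card_partial_orders_on_nat_ge by (intro mult_left_mono) auto
  finally have "real ((2 * n) ^ (n * k)) \<le> 2 powr (1 / 4 - real n) * ?c" .
  moreover have "?c > 0"
    using card_partial_orders_on_nat_ge[of n] by (smt (verit) powr_gt_zero)
  ultimately have frac: "real ((2 * n) ^ (n * k)) / ?c \<le> 2 powr (1 / 4 - real n)"
    by (simp add: pos_divide_le_eq)
  \<comment> \<open>This makes the second factor nonnegative, as replacing \<open>q\<close> by
    \<open>k + 1\<close> requires.\<close>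
  have "(2::real) powr (1 / 4 - real n) \<le> 2 powr 0" using assms by (intro powr_mono) auto
  then have "q * (1 - 2 powr (1 / 4 - real n)) \<le> (real k + 1) * (1 - 2 powr (1 / 4 - real n))"
    using k(2) by (intro mult_right_mono) auto
  also have "\<dots> \<le> (real k + 1) * (1 - real ((2 * n) ^ (n * k)) / ?c)"
    using frac by (intro mult_left_mono) auto
  also have "\<dots> \<le> expected_ldim n" using expected_ldim_ge_tail[of n k] assms by linarith
  finally show ?thesis by (simp add: q_def)
qed

theorem theorem4:
  shows "\<exists>\<epsilon> :: nat \<Rightarrow> real. \<epsilon> \<in> o(\<lambda>_. 1) \<and>
    (\<forall>\<^sub>F n in sequentially. expected_ldim n \<ge> (1 / 4 - \<epsilon> n) * (real n / log 2 (real n)))"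
proof -
  define b where "b n = (real n / 4 - 1) / log 2 (2 * real n) * (1 - 2 powr (1 / 4 - real n))"
    for n :: nat
  \<comment> \<open>Chosen so that the target equals \<open>b n\<close> exactly. What remains is
    that the quotient tends to \<open>1 / 4\<close>, because
    \<open>log 2 (2 * n) = 1 + log 2 n\<close> for positive \<open>n\<close> and the last factor of
    \<open>b n\<close> tends to \<open>1\<close>.\<close>
  define \<epsilon> where "\<epsilon> n = 1 / 4 - b n / (real n / log 2 (real n))" for n :: nat
  have "\<epsilon> \<in> o(\<lambda>_. 1)"
    unfolding \<epsilon>_def b_def by real_asymp
  moreover have "\<forall>\<^sub>F n in sequentially.
      expected_ldim n \<ge> (1 / 4 - \<epsilon> n) * (real n / log 2 (real n))"
    using eventually_ge_at_top[of 4]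
  proof eventually_elim
    case (elim n)
    then have "log 2 (real n) > 0" "real n > 0" by simp_all
    then have "log 2 (real n) \<noteq> 0" "real n \<noteq> 0" by linarith+
    then have "(1 / 4 - \<epsilon> n) * (real n / log 2 (real n)) = b n"
      by (simp add: \<epsilon>_def)
    then show ?case using expected_ldim_ge[OF elim] by (simp add: b_def)
  qed
  ultimately show ?thesis by blast
qed

end
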